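(* Let $\lambda_1,\lambda_2>0$, let $y,y_0\in\Omega_Y$ be fixed, and let $U_i(y)=d_Y^2(Y_i,y)-d_Y^2(Y_i,y_0)$, $i=1,\dots,n$. A tuple $(f_1,\dots,f_p)$ with $f_j\in\mathcal M_j$ is a solution of $$\min_{f_1\in\mathcal M_1,\dots,f_p\in\mathcal M_p}\ \frac1{2n}\sum_{i=1}^n\Big(U_i(y)-\sum_{j=1}^p\langle f_j,\kappa_j(\cdot,X_{ij})\rangle_{\mathcal M_j}\Big)^2+\lambda_1\sum_{j=1}^p\|f_j\|_{\mathcal M_j}+\frac{\lambda_2}{2}\sum_{j=1}^p\|f_j\|_{\mathcal M_j}^2$$ if and only if for every $j\in\{1,\dots,p\}$ the following hold: (i) if $\|f_j\|_{\mathcal M_j}>0$, then $$\frac1n\sum_{i=1}^n\Big(U_i(y)-\sum_{k=1}^p\langle f_k,\kappa_k(\cdot,X_{ik})\rangle_{\mathcal M_k}\Big)\kappa_j(\cdot,X_{ij})-\lambda_2 f_j=\lambda_1\frac{f_j}{\|f_j\|_{\mathcal M_j}};$$ (ii) if $\|f_j\|_{\mathcal M_j}=0$, then $$\Big\|\frac1n\sum_{i=1}^n\Big(U_i(y)-\sum_{k=1}^p\langle f_k,\kappa_k(\cdot,X_{ik})\rangle_{\mathcal M_k}\Big)\kappa_j(\cdot,X_{ij})\Big\|_{\mathcal M_j}\le\lambda_1 .$$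
   Context: $(\Omega_Y,d_Y)$ is a metric space and $Y_1,\dots,Y_n\in\Omega_Y$ are observed responses. For each $j=1,\dots,p$, $\Omega_{X_j}$ is a separable metric space, $X_{1j},\dots,X_{nj}\in\Omega_{X_j}$ are the observed values of the $j$-th covariate, $\kappa_j:\Omega_{X_j}\times\Omega_{X_j}\to\mathbb R$ is a positive definite kernel (symmetric, with all Gram matrices positive semidefinite), and $\mathcal M_j$ is the reproducing kernel Hilbert space generated by $\kappa_j$, so that $f(x)=\langle f,\kappa_j(\cdot,x)\rangle_{\mathcal M_j}$ for $f\in\mathcal M_j$, $x\in\Omega_{X_j}$. *)

theory Defs
  imports "HOL-Analysis.Analysis"
begin

definition pos_def_kernel :: "'x set \<Rightarrow> ('x \<Rightarrow> 'x \<Rightarrow> real) \<Rightarrow> bool" where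
  "pos_def_kernel S \<kappa> \<longleftrightarrow>
     (\<forall>s\<in>S. \<forall>t\<in>S. \<kappa> s t = \<kappa> t s) \<and>
     (\<forall>(m::nat) x (c :: nat \<Rightarrow> real). (\<forall>i<m. x i \<in> S) \<longrightarrow>
        0 \<le> (\<Sum>i<m. \<Sum>j<m. c i * c j * \<kappa> (x i) (x j)))"

text \<open>Real functions on a set \<open>S\<close> are represented by total functions that vanish outside \<open>S\<close>,
  so that the pointwise vector space operations and equality of functions on \<open>S\<close> are the plain
  ones.  In particular the function \<open>\<kappa>(\<cdot>, x)\<close> on \<open>S\<close> is cut off outside \<open>S\<close>.\<close>

definition kernel_section :: "'x set \<Rightarrow> ('x \<Rightarrow> 'x \<Rightarrow> real) \<Rightarrow> 'x \<Rightarrow> 'x \<Rightarrow> real" where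
  "kernel_section S \<kappa> x = (\<lambda>t. if t \<in> S then \<kappa> t x else 0)"

definition ip_norm :: "('v \<Rightarrow> 'v \<Rightarrow> real) \<Rightarrow> 'v \<Rightarrow> real" where
  "ip_norm ip f = sqrt (ip f f)"

locale inner_function_space =
  fixes S :: "'x set"
    and H :: "('x \<Rightarrow> real) set"
    and ip :: "('x \<Rightarrow> real) \<Rightarrow> ('x \<Rightarrow> real) \<Rightarrow> real"
  assumes vanish: "\<lbrakk>f \<in> H; x \<notin> S\<rbrakk> \<Longrightarrow> f x = 0"
    and zero_mem: "(\<lambda>x. 0) \<in> H"
    and add_mem: "\<lbrakk>f \<in> H; g \<in> H\<rbrakk> \<Longrightarrow> (\<lambda>x. f x + g x) \<in> H"
    and scale_mem: "f \<in> H \<Longrightarrow> (\<lambda>x. c * f x) \<in> H"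
    and ip_commute: "\<lbrakk>f \<in> H; g \<in> H\<rbrakk> \<Longrightarrow> ip f g = ip g f"
    and ip_add_left: "\<lbrakk>f \<in> H; g \<in> H; h \<in> H\<rbrakk> \<Longrightarrow> ip (\<lambda>x. f x + g x) h = ip f h + ip g h"
    and ip_scale_left: "\<lbrakk>f \<in> H; g \<in> H\<rbrakk> \<Longrightarrow> ip (\<lambda>x. c * f x) g = c * ip f g"
    and ip_nonneg: "f \<in> H \<Longrightarrow> 0 \<le> ip f f"
    and ip_eq_zero: "\<lbrakk>f \<in> H; ip f f = 0\<rbrakk> \<Longrightarrow> f = (\<lambda>x. 0)"

text \<open>The Hilbert space of functions on \<open>S\<close> with reproducing kernel \<open>\<kappa>\<close>: its elements are actual
  functions, and \<open>\<kappa>\<close> determines both the carrier and the inner product on it.\<close>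

locale rkhs = inner_function_space S H ip
  for S :: "'x set"
    and \<kappa> :: "'x \<Rightarrow> 'x \<Rightarrow> real"
    and H :: "('x \<Rightarrow> real) set"
    and ip :: "('x \<Rightarrow> real) \<Rightarrow> ('x \<Rightarrow> real) \<Rightarrow> real" +
  assumes complete:
      "\<lbrakk>\<And>n. \<sigma> n \<in> H;
        \<And>e. e > 0 \<Longrightarrow> \<exists>N. \<forall>m\<ge>N. \<forall>n\<ge>N. ip_norm ip (\<lambda>x. \<sigma> m x - \<sigma> n x) < e\<rbrakk>
       \<Longrightarrow> \<exists>g\<in>H. (\<lambda>n. ip_norm ip (\<lambda>x. \<sigma> n x - g x)) \<longlonglongrightarrow> 0"
    and section_mem: "x \<in> S \<Longrightarrow> kernel_section S \<kappa> x \<in> H"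
    and reproducing: "\<lbrakk>f \<in> H; x \<in> S\<rbrakk> \<Longrightarrow> f x = ip f (kernel_section S \<kappa> x)"

text \<open>Below, \<open>K i j\<close> stands for the section \<open>\<kappa>\<^sub>j(\<cdot>, X\<^sub>i\<^sub>j)\<close> and \<open>ip j\<close> for the inner product of the
  \<open>j\<close>-th function space.\<close>

definition residual ::
  "nat \<Rightarrow> (nat \<Rightarrow> 'v \<Rightarrow> 'v \<Rightarrow> real) \<Rightarrow> (nat \<Rightarrow> real) \<Rightarrow> (nat \<Rightarrow> nat \<Rightarrow> 'v) \<Rightarrow> (nat \<Rightarrow> 'v) \<Rightarrow> nat \<Rightarrow> real"
where
  "residual p ip U K f i = U i - (\<Sum>j=1..p. ip j (f j) (K i j))"

definition penalized_objective ::
  "nat \<Rightarrow> nat \<Rightarrow> (nat \<Rightarrow> 'v \<Rightarrow> 'v \<Rightarrow> real) \<Rightarrow> (nat \<Rightarrow> real) \<Rightarrow> (nat \<Rightarrow> nat \<Rightarrow> 'v) \<Rightarrow>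
   real \<Rightarrow> real \<Rightarrow> (nat \<Rightarrow> 'v) \<Rightarrow> real"
where
  "penalized_objective n p ip U K lam1 lam2 f =
     1 / (2 * real n) * (\<Sum>i=1..n. (residual p ip U K f i)\<^sup>2)
     + lam1 * (\<Sum>j=1..p. ip_norm (ip j) (f j))
     + lam2 / 2 * (\<Sum>j=1..p. (ip_norm (ip j) (f j))\<^sup>2)"

definition residual_mean ::
  "nat \<Rightarrow> nat \<Rightarrow> (nat \<Rightarrow> ('x \<Rightarrow> real) \<Rightarrow> ('x \<Rightarrow> real) \<Rightarrow> real) \<Rightarrow> (nat \<Rightarrow> real) \<Rightarrow>
   (nat \<Rightarrow> nat \<Rightarrow> 'x \<Rightarrow> real) \<Rightarrow> (nat \<Rightarrow> 'x \<Rightarrow> real) \<Rightarrow> nat \<Rightarrow> 'x \<Rightarrow> real"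
where
  "residual_mean n p ip U K f j = (\<lambda>t. 1 / real n * (\<Sum>i=1..n. residual p ip U K f i * K i j t))"

end

theory Submission
  imports Defs
begin

text \<open>
  The objective is a convex quadratic in the tuple \<open>f\<close> plus a sum of terms
  \<open>\<phi>\<^sub>j(f\<^sub>j) = \<lambda>\<^sub>1 \<parallel>f\<^sub>j\<parallel> + \<lambda>\<^sub>2/2 \<parallel>f\<^sub>j\<parallel>\<^sup>2\<close>, each depending on one block only.  The
  residuals are affine in \<open>f\<close>, with the sections \<open>\<kappa>\<^sub>j(\<cdot>, X\<^sub>i\<^sub>j)\<close> representing their linear parts, so
  the quadratic part has at \<open>f\<close> the partial gradient \<open>-G\<^sub>j\<close> in \<open>M\<^sub>j\<close>, where \<open>G\<^sub>j\<close> is the average of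
  these sections weighted by the residuals at \<open>f\<close>.
  Convexity, together with the fact that the non-smooth part separates over the blocks, suggests
  that \<open>f\<close> is a minimizer iff \<open>G\<^sub>j\<close> is a subgradient of \<open>\<phi>\<^sub>j\<close> at \<open>f\<^sub>j\<close> for every \<open>j\<close>.

  This rests on the second-order expansion \<open>objective_expansion\<close>, an exact identity whose
  remainder is a nonnegative multiple of a sum of squares.  Dropping it gives sufficiency.  For necessity,
  one block is moved from \<open>f\<^sub>j\<close> a fraction \<open>t\<close> of the way towards \<open>u\<close>; the remainder is then of order
  \<open>t\<^sup>2\<close>, whereas convexity bounds the change of \<open>\<phi>\<^sub>j\<close> linearly in \<open>t\<close>, so that dividing by \<open>t\<close>
  and letting \<open>t\<close> tend to \<open>0\<close> leaves the subgradient inequality (\<open>minimizer_iff_subgradient\<close>).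

  It remains to compute the subgradients of \<open>\<phi>\<^sub>j\<close>.  Away from the origin the norm is smooth and
  the only subgradient is \<open>\<lambda>\<^sub>2 f\<^sub>j + \<lambda>\<^sub>1 f\<^sub>j / \<parallel>f\<^sub>j\<parallel>\<close>; at the origin the subgradients form the ball
  of radius \<open>\<lambda>\<^sub>1\<close>.  These are the conditions (i) and (ii).
\<close>

section \<open>Geometry of an inner product space of functions\<close>

context inner_function_space
begin

lemma diff_mem: "(\<lambda>x. f x - g x) \<in> H" if "f \<in> H" "g \<in> H"
  using add_mem[OF that(1) scale_mem[OF that(2), of "-1"]] by simp

lemma lin_comb_mem: "(\<lambda>x. a * f x + b * g x) \<in> H" if "f \<in> H" "g \<in> H"
  using that by (intro add_mem scale_mem)

lemma ip_lin_comb_left: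
  "ip (\<lambda>x. a * f x + b * g x) h = a * ip f h + b * ip g h" if "f \<in> H" "g \<in> H" "h \<in> H"
  using that by (simp add: ip_add_left ip_scale_left scale_mem)

lemma ip_lin_comb_right:
  "ip h (\<lambda>x. a * f x + b * g x) = a * ip h f + b * ip h g" if "f \<in> H" "g \<in> H" "h \<in> H"
  using that ip_lin_comb_left[OF that, of a b]
  by (simp add: ip_commute[OF that(3)] lin_comb_mem)

lemma ip_diff_left: "ip (\<lambda>x. f x - g x) h = ip f h - ip g h" if "f \<in> H" "g \<in> H" "h \<in> H"
  using ip_lin_comb_left[OF that, of 1 "-1"] by simp

lemma ip_diff_right: "ip h (\<lambda>x. f x - g x) = ip h f - ip h g" if "f \<in> H" "g \<in> H" "h \<in> H"
  using ip_lin_comb_right[OF that, of 1 "-1"] by simp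

lemma ip_scale_right: "ip g (\<lambda>x. c * f x) = c * ip g f" if "f \<in> H" "g \<in> H"
  using that by (metis ip_commute ip_scale_left scale_mem)

lemma ip_zero_left: "ip (\<lambda>x. 0) f = 0" if "f \<in> H"
  using ip_scale_left[OF zero_mem that, of 0] by simp

lemma ip_zero_right: "ip f (\<lambda>x. 0) = 0" if "f \<in> H"
  using that by (metis ip_commute ip_zero_left zero_mem)

lemma sum_mem: "(\<lambda>x. \<Sum>i\<in>A. c i * k i x) \<in> H" if "\<And>i. i \<in> A \<Longrightarrow> k i \<in> H"
  using that
proof (induction A rule: infinite_finite_induct)
  case (insert a A)
  then show ?case by (auto intro!: add_mem scale_mem)
qed (auto simp: zero_mem)

lemma ip_sum_left:
  "ip (\<lambda>x. \<Sum>i\<in>A. c i * k i x) h = (\<Sum>i\<in>A. c i * ip (k i) h)"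
  if "h \<in> H" "\<And>i. i \<in> A \<Longrightarrow> k i \<in> H"
  using that(2)
proof (induction A rule: infinite_finite_induct)
  case (insert a A)
  then show ?case
    by (simp add: ip_add_left ip_scale_left scale_mem sum_mem that(1))
qed (auto simp: ip_zero_left that(1))

lemma ip_norm_square: "(ip_norm ip f)\<^sup>2 = ip f f" if "f \<in> H"
  by (simp add: ip_norm_def ip_nonneg that)

lemma ip_norm_nonneg: "0 \<le> ip_norm ip f" if "f \<in> H"
  by (simp add: ip_norm_def ip_nonneg that)

lemma ip_norm_eq_zero: "f = (\<lambda>x. 0)" if "f \<in> H" "ip_norm ip f = 0"
  using that by (simp add: ip_norm_def ip_eq_zero)

lemma ip_norm_zero: "ip_norm ip (\<lambda>x. 0) = 0"
  by (simp add: ip_norm_def ip_zero_left zero_mem)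

lemma ip_norm_scale: "ip_norm ip (\<lambda>x. c * f x) = \<bar>c\<bar> * ip_norm ip f" if "f \<in> H"
  by (simp add: ip_norm_def ip_scale_left ip_scale_right scale_mem that real_sqrt_mult
      flip: mult.assoc)

text \<open>Expands the square of the norm of \<open>b f - a g\<close>, where \<open>a\<close> and \<open>b\<close> are the norms of \<open>f\<close> and \<open>g\<close>.\<close>

lemma cauchy_schwarz: "ip f g \<le> ip_norm ip f * ip_norm ip g" if "f \<in> H" "g \<in> H"
proof (cases "ip_norm ip f = 0 \<or> ip_norm ip g = 0")
  case True
  then show ?thesis
    using that ip_norm_eq_zero ip_zero_left ip_zero_right ip_norm_nonneg by fastforce
next
  case False
  define a b where "a = ip_norm ip f" and "b = ip_norm ip g"
  have pos: "a * b > 0"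
    using False ip_norm_nonneg that unfolding a_def b_def by (simp add: order_less_le)
  have expand: "ip (\<lambda>x. s * f x + t * g x) (\<lambda>x. s * f x + t * g x)
      = s * s * ip f f + 2 * s * t * ip f g + t * t * ip g g" for s t
    using that ip_commute[OF that]
    by (simp add: ip_lin_comb_left ip_lin_comb_right lin_comb_mem algebra_simps)
  have "0 \<le> ip (\<lambda>x. b * f x + (- a) * g x) (\<lambda>x. b * f x + (- a) * g x)"
    by (intro ip_nonneg lin_comb_mem that)
  also have "\<dots> = b * b * ip f f - 2 * a * b * ip f g + a * a * ip g g"
    by (subst expand) simp
  also have "\<dots> = 2 * (a * b) * (a * b - ip f g)"
    using that unfolding a_def b_def
    by (simp flip: ip_norm_square add: algebra_simps power2_eq_square)
  finally show ?thesis
    using pos unfolding a_def b_def by (simp add: zero_le_mult_iff)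
qed

lemma ip_norm_triangle:
  "ip_norm ip (\<lambda>x. f x + g x) \<le> ip_norm ip f + ip_norm ip g" if "f \<in> H" "g \<in> H"
proof (rule power2_le_imp_le)
  have "(ip_norm ip (\<lambda>x. f x + g x))\<^sup>2 = ip f f + 2 * ip f g + ip g g"
    using that ip_lin_comb_left[of f g _ 1 1] ip_lin_comb_right[of f g _ 1 1] ip_commute[OF that]
    by (simp add: ip_norm_square add_mem)
  also have "\<dots> \<le> (ip_norm ip f + ip_norm ip g)\<^sup>2"
    using cauchy_schwarz[OF that] by (simp add: power2_sum ip_norm_square that)
  finally show "(ip_norm ip (\<lambda>x. f x + g x))\<^sup>2 \<le> (ip_norm ip f + ip_norm ip g)\<^sup>2" .
qed (simp add: ip_norm_nonneg that)

end

section \<open>Subgradients of the elastic net penalty\<close>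

definition elastic_net_penalty where
  "elastic_net_penalty ip lam1 lam2 u = lam1 * ip_norm ip u + lam2 / 2 * (ip_norm ip u)\<^sup>2"

text \<open>Carries the passages to the limit \<open>t \<rightarrow> 0\<close> below: a first-order term dominated by a
  second-order one cannot be positive.\<close>

lemma linear_coeff_nonpos:
  fixes a c :: real
  assumes "\<And>t. 0 < t \<Longrightarrow> t \<le> 1 \<Longrightarrow> t * a \<le> t\<^sup>2 * c"
  shows "a \<le> 0"
proof (rule ccontr)
  assume "\<not> a \<le> 0"
  define t where "t = min 1 (a / (2 * (\<bar>c\<bar> + 1)))"
  have t: "0 < t" "t \<le> 1" "t \<le> a / (2 * (\<bar>c\<bar> + 1))"
    using \<open>\<not> a \<le> 0\<close> by (auto simp: t_def)
  have "t * a \<le> t * (t * c)"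
    using assms[OF t(1,2)] by (simp add: power2_eq_square mult.assoc)
  then have "a \<le> t * c"
    using t(1) by simp
  also have "\<dots> \<le> t * (\<bar>c\<bar> + 1)"
    using t(1) by (intro mult_left_mono) auto
  also have "\<dots> \<le> a / 2"
    using t(3) by (simp add: pos_le_divide_eq field_simps)
  finally show False
    using \<open>\<not> a \<le> 0\<close> by simp
qed

context inner_function_space
begin

text \<open>As a subgradient, \<open>g\<close> stands for the functional \<open>ip g\<close> that it represents.\<close>

definition subgradient where
  "subgradient \<phi> f g \<longleftrightarrow> (\<forall>u\<in>H. \<phi> f + ip g (\<lambda>x. u x - f x) \<le> \<phi> u)"

text \<open>The penalty is the function \<open>s \<mapsto> lam1 s + lam2/2 s\<^sup>2\<close> of the norm, which is monotone and convex on
  \<open>s \<ge> 0\<close>, and the norm is convex by the triangle inequality.\<close>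

lemma elastic_net_penalty_convex:
  assumes "0 \<le> lam1" "0 \<le> lam2" "f \<in> H" "u \<in> H" "0 \<le> t" "t \<le> 1"
  defines "\<phi> \<equiv> elastic_net_penalty ip lam1 lam2"
  shows "\<phi> (\<lambda>x. (1 - t) * f x + t * u x) \<le> (1 - t) * \<phi> f + t * \<phi> u"
proof -
  define a b c where "a = ip_norm ip f" and "b = ip_norm ip u"
    and "c = ip_norm ip (\<lambda>x. (1 - t) * f x + t * u x)"
  have c: "0 \<le> c" "c \<le> (1 - t) * a + t * b"
    using ip_norm_triangle[of "\<lambda>x. (1 - t) * f x" "\<lambda>x. t * u x"] assms
    by (simp_all add: a_def b_def c_def ip_norm_scale scale_mem ip_norm_nonneg lin_comb_mem)
  have "c\<^sup>2 \<le> ((1 - t) * a + t * b)\<^sup>2"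
    using c by (intro power_mono)
  also have "\<dots> = (1 - t) * a\<^sup>2 + t * b\<^sup>2 - t * (1 - t) * (a - b)\<^sup>2"
    by (simp add: power2_eq_square algebra_simps)
  also have "\<dots> \<le> (1 - t) * a\<^sup>2 + t * b\<^sup>2"
    using assms by simp
  finally have "lam2 / 2 * c\<^sup>2 \<le> lam2 / 2 * ((1 - t) * a\<^sup>2 + t * b\<^sup>2)"
    using assms by (intro mult_left_mono) auto
  moreover have "lam1 * c \<le> lam1 * ((1 - t) * a + t * b)"
    using c assms by (intro mult_left_mono) auto
  ultimately show ?thesis
    unfolding \<phi>_def elastic_net_penalty_def a_def[symmetric] b_def[symmetric] c_def[symmetric]
    by (simp add: algebra_simps diff_divide_distrib)
qed

text \<open>At the origin the norm has the unit ball as its set of subgradients and the squared norm is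
  flat to first order.  Sufficiency is the Cauchy-Schwarz inequality; the worst direction, which
  forces the bound, is that of \<open>g\<close> itself.\<close>

lemma subgradient_elastic_net_at_zero:
  assumes "0 \<le> lam1" "0 \<le> lam2" "g \<in> H"
  shows "subgradient (elastic_net_penalty ip lam1 lam2) (\<lambda>x. 0) g \<longleftrightarrow> ip_norm ip g \<le> lam1"
proof
  assume sub: "subgradient (elastic_net_penalty ip lam1 lam2) (\<lambda>x. 0) g"
  define N where "N = ip_norm ip g"
  have "N\<^sup>2 - lam1 * N \<le> 0"
  proof (rule linear_coeff_nonpos)
    fix t :: real assume t: "0 < t" "t \<le> 1"
    have "ip g (\<lambda>x. t * g x) \<le> elastic_net_penalty ip lam1 lam2 (\<lambda>x. t * g x)"
      using sub scale_mem[OF assms(3), of t]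
      by (force simp: subgradient_def elastic_net_penalty_def ip_norm_zero)
    then show "t * (N\<^sup>2 - lam1 * N) \<le> t\<^sup>2 * (lam2 / 2 * N\<^sup>2)"
      using assms t
      by (simp add: elastic_net_penalty_def ip_norm_scale ip_scale_right N_def ip_norm_square
          algebra_simps power_mult_distrib)
  qed
  then have "N * (N - lam1) \<le> 0"
    by (simp add: power2_eq_square algebra_simps)
  moreover have "0 \<le> N"
    unfolding N_def using assms by (simp add: ip_norm_nonneg)
  ultimately show "ip_norm ip g \<le> lam1"
    using assms unfolding N_def[symmetric] by (auto simp: mult_le_0_iff)
next
  assume le: "ip_norm ip g \<le> lam1"
  have "ip g u \<le> elastic_net_penalty ip lam1 lam2 u" if u: "u \<in> H" for u
  proof -
    have "ip g u \<le> ip_norm ip g * ip_norm ip u"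
      by (rule cauchy_schwarz[OF assms(3) u])
    also have "\<dots> \<le> lam1 * ip_norm ip u"
      by (intro mult_right_mono le ip_norm_nonneg u)
    also have "\<dots> \<le> elastic_net_penalty ip lam1 lam2 u"
      using assms by (simp add: elastic_net_penalty_def)
    finally show ?thesis .
  qed
  then show "subgradient (elastic_net_penalty ip lam1 lam2) (\<lambda>x. 0) g"
    by (simp add: subgradient_def elastic_net_penalty_def ip_norm_zero)
qed

text \<open>Uniqueness of the subgradient \<open>s f\<close>, with \<open>s = lam2 + lam1 / \<parallel>f\<parallel>\<close>, reflects smoothness of the
  penalty near \<open>f\<close>: moving from \<open>f\<close> by \<open>t w\<close> in the direction of the discrepancy \<open>w = g - s f\<close>
  changes the penalty by at most \<open>t \<langle>s f, w\<rangle>\<close> up to a term of order \<open>t\<^sup>2\<close>, while a subgradient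
  \<open>g\<close> demands at least \<open>t \<langle>g, w\<rangle>\<close>.  Hence \<open>\<langle>w, w\<rangle> \<le> 0\<close>.\<close>

lemma subgradient_elastic_net_at_nonzero:
  assumes "0 \<le> lam1" "0 \<le> lam2" "f \<in> H" "g \<in> H" and pos: "ip_norm ip f > 0"
  shows "subgradient (elastic_net_penalty ip lam1 lam2) f g \<longleftrightarrow>
         (\<lambda>x. g x - lam2 * f x) = (\<lambda>x. lam1 * (f x / ip_norm ip f))"
proof
  define N where "N = ip_norm ip f"
  have N: "N > 0" "ip f f = N\<^sup>2"
    using assms by (simp_all add: N_def ip_norm_square)
  define s where "s = lam2 + lam1 / N"
  have lam2: "lam2 = s - lam1 / N"
    by (simp add: s_def)
  {
    assume sub: "subgradient (elastic_net_penalty ip lam1 lam2) f g"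
    define w where "w = (\<lambda>x. 1 * g x + (- s) * f x)"
    have w: "w \<in> H"
      unfolding w_def using assms by (intro lin_comb_mem)
    have "ip w w \<le> 0"
    proof (rule linear_coeff_nonpos)
      fix t :: real assume t: "0 < t" "t \<le> 1"
      define u where "u = (\<lambda>x. 1 * f x + t * w x)"
      define m where "m = ip_norm ip u"
      have u: "u \<in> H"
        unfolding u_def using assms w by (intro lin_comb_mem)
      have m2: "m\<^sup>2 = N\<^sup>2 + 2 * t * ip f w + t\<^sup>2 * ip w w"
      proof -
        have "m\<^sup>2 = ip u u"
          by (simp add: m_def ip_norm_square u)
        also have "\<dots> = 1 * ip f u + t * ip w u"
          by (subst (1) u_def, rule ip_lin_comb_left) (use assms w u in auto)
        also have "ip f u = 1 * ip f f + t * ip f w"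
          unfolding u_def by (rule ip_lin_comb_right) (use assms w in auto)
        also have "ip w u = 1 * ip w f + t * ip w w"
          unfolding u_def by (rule ip_lin_comb_right) (use assms w in auto)
        finally show ?thesis
          using ip_commute[OF w assms(3)] N by (simp add: power2_eq_square algebra_simps)
      qed
      \<comment> \<open>The tangent to the square root at \<open>N\<^sup>2\<close> lies above it, which linearizes the norm.\<close>
      have "0 \<le> (m - N)\<^sup>2"
        by simp
      then have m1: "m - N \<le> (m\<^sup>2 - N\<^sup>2) / (2 * N)"
        using N by (simp add: field_simps power2_eq_square)
      have "(\<lambda>x. u x - f x) = (\<lambda>x. t * w x)"
        by (simp add: u_def)
      then have "t * ip g w \<le> lam1 * (m - N) + lam2 / 2 * (m\<^sup>2 - N\<^sup>2)"
        using bspec[OF sub[unfolded subgradient_def] u] assms w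
        by (simp add: elastic_net_penalty_def ip_scale_right algebra_simps N_def m_def)
      also have "\<dots> \<le> lam1 * ((m\<^sup>2 - N\<^sup>2) / (2 * N)) + lam2 / 2 * (m\<^sup>2 - N\<^sup>2)"
        using mult_left_mono[OF m1 assms(1)] by simp
      also have "\<dots> = s / 2 * (m\<^sup>2 - N\<^sup>2)"
        using N by (simp add: s_def field_simps)
      also have "\<dots> = t * (s * ip f w) + t\<^sup>2 * (s / 2 * ip w w)"
        unfolding m2 by (simp add: algebra_simps)
      finally have "t * (ip g w - s * ip f w) \<le> t\<^sup>2 * (s / 2 * ip w w)"
        by (simp add: algebra_simps)
      moreover have "ip w w = ip g w - s * ip f w"
        using ip_lin_comb_left[OF assms(4,3) w, of 1 "- s"] unfolding w_def[symmetric] by simp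
      ultimately show "t * ip w w \<le> t\<^sup>2 * (s / 2 * ip w w)"
        by simp
    qed
    then have "w = (\<lambda>x. 0)"
      using ip_eq_zero[OF w] ip_nonneg[OF w] by simp
    then have "g x = s * f x" for x
      by (auto simp: w_def dest!: fun_cong[of _ _ x])
    then show "(\<lambda>x. g x - lam2 * f x) = (\<lambda>x. lam1 * (f x / ip_norm ip f))"
      by (simp add: lam2 N_def algebra_simps)
  }
  {
    assume "(\<lambda>x. g x - lam2 * f x) = (\<lambda>x. lam1 * (f x / ip_norm ip f))"
    then have g: "g = (\<lambda>x. s * f x)"
      by (auto simp: s_def N_def fun_eq_iff algebra_simps)
    show "subgradient (elastic_net_penalty ip lam1 lam2) f g"
      unfolding subgradient_def
    proof
      fix u assume u: "u \<in> H"
      define m where "m = ip_norm ip u"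
      have cs: "ip f u \<le> N * m"
        unfolding N_def m_def by (rule cauchy_schwarz[OF assms(3) u])
      have "ip g (\<lambda>x. u x - f x) = s * (ip f u - N\<^sup>2)"
        using assms u N by (simp add: g ip_scale_left diff_mem ip_diff_right)
      also have "\<dots> \<le> s * (N * m - N\<^sup>2)"
        using cs assms N by (intro mult_left_mono) (auto simp: s_def)
      also have "\<dots> = lam1 * (m - N) + lam2 / 2 * (m\<^sup>2 - N\<^sup>2) - lam2 / 2 * (m - N)\<^sup>2"
        using N by (simp add: s_def field_simps power2_eq_square)
      also have "\<dots> \<le> lam1 * (m - N) + lam2 / 2 * (m\<^sup>2 - N\<^sup>2)"
        using assms by simp
      finally show "elastic_net_penalty ip lam1 lam2 f + ip g (\<lambda>x. u x - f x)
                    \<le> elastic_net_penalty ip lam1 lam2 u"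
        by (simp add: elastic_net_penalty_def m_def N_def algebra_simps)
    qed
  }
qed

end

section \<open>The penalized least squares problem\<close>

text \<open>The features \<open>K i j\<close> enter the problem only as elements of \<open>M j\<close>: the inner product with
  \<open>K i j\<close> is the functional observed at the \<open>i\<close>-th data point.\<close>

locale additive_model =
  fixes n p :: nat
    and S :: "nat \<Rightarrow> 'x set"
    and M :: "nat \<Rightarrow> ('x \<Rightarrow> real) set"
    and ip :: "nat \<Rightarrow> ('x \<Rightarrow> real) \<Rightarrow> ('x \<Rightarrow> real) \<Rightarrow> real"
    and U :: "nat \<Rightarrow> real"
    and K :: "nat \<Rightarrow> nat \<Rightarrow> 'x \<Rightarrow> real"
  assumes space: "j \<in> {1..p} \<Longrightarrow> inner_function_space (S j) (M j) (ip j)"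
    and feature_mem: "\<lbrakk>i \<in> {1..n}; j \<in> {1..p}\<rbrakk> \<Longrightarrow> K i j \<in> M j"
begin

lemma residual_mean_alt:
  "residual_mean n p ip U K f j = (\<lambda>t. \<Sum>i=1..n. (residual p ip U K f i / real n) * K i j t)"
  by (simp add: residual_mean_def sum_distrib_left)

lemma residual_mean_mem: "residual_mean n p ip U K f j \<in> M j" if j: "j \<in> {1..p}"
proof -
  interpret inner_function_space "S j" "M j" "ip j" by (rule space[OF j])
  show ?thesis
    unfolding residual_mean_alt by (intro sum_mem feature_mem j)
qed

lemma ip_residual_mean:
  assumes j: "j \<in> {1..p}" and d: "d \<in> M j"
  shows "ip j (residual_mean n p ip U K f j) d
         = (\<Sum>i=1..n. residual p ip U K f i * ip j d (K i j)) / real n"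
proof -
  interpret inner_function_space "S j" "M j" "ip j" by (rule space[OF j])
  have "ip j (residual_mean n p ip U K f j) d
        = (\<Sum>i=1..n. (residual p ip U K f i / real n) * ip j (K i j) d)"
    unfolding residual_mean_alt by (rule ip_sum_left[OF d]) (rule feature_mem[OF _ j])
  also have "\<dots> = (\<Sum>i=1..n. (residual p ip U K f i / real n) * ip j d (K i j))"
    by (intro sum.cong refl) (simp add: ip_commute[OF feature_mem[OF _ j] d])
  finally show ?thesis
    by (simp add: sum_divide_distrib)
qed

text \<open>The second-order Taylor expansion of the squared loss is exact, because the residuals are affine
  in the tuple.  Its linear part is minus the sum of the inner products of \<open>residual_mean\<close> with the
  increments, and it is grouped here with the change of the penalty, block by block.\<close>

lemma objective_expansion:
  assumes f: "\<And>j. j \<in> {1..p} \<Longrightarrow> f j \<in> M j" and h: "\<And>j. j \<in> {1..p} \<Longrightarrow> h j \<in> M j"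
  defines "d \<equiv> \<lambda>j x. h j x - f j x"
  shows "penalized_objective n p ip U K lam1 lam2 h - penalized_objective n p ip U K lam1 lam2 f
    = (\<Sum>j=1..p. elastic_net_penalty (ip j) lam1 lam2 (h j)
                 - elastic_net_penalty (ip j) lam1 lam2 (f j)
                 - ip j (residual_mean n p ip U K f j) (d j))
      + (\<Sum>i=1..n. (\<Sum>j=1..p. ip j (d j) (K i j))\<^sup>2) / (2 * real n)"
proof -
  define r where "r = residual p ip U K f"
  define a where "a i = (\<Sum>j=1..p. ip j (d j) (K i j))" for i
  have d: "d j \<in> M j" if "j \<in> {1..p}" for j
    unfolding d_def by (rule inner_function_space.diff_mem[OF space[OF that] h[OF that] f[OF that]])
  have res: "residual p ip U K h i = r i - a i" if i: "i \<in> {1..n}" for i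
  proof -
    have "a i = (\<Sum>j=1..p. ip j (h j) (K i j) - ip j (f j) (K i j))"
      unfolding a_def d_def
      by (intro sum.cong refl inner_function_space.ip_diff_left[OF space] h f feature_mem i)
    then show ?thesis
      by (simp add: r_def residual_def sum_subtractf)
  qed
  have "(\<Sum>j=1..p. ip j (residual_mean n p ip U K f j) (d j))
        = (\<Sum>j=1..p. (\<Sum>i=1..n. r i * ip j (d j) (K i j)) / real n)"
    by (intro sum.cong refl) (simp add: ip_residual_mean d r_def)
  also have "\<dots> = (\<Sum>j=1..p. \<Sum>i=1..n. r i * ip j (d j) (K i j)) / real n"
    by (simp add: sum_divide_distrib)
  also have "\<dots> = (\<Sum>i=1..n. r i * a i) / real n"
    by (subst sum.swap) (simp add: a_def sum_distrib_left)
  finally have lin: "(\<Sum>j=1..p. ip j (residual_mean n p ip U K f j) (d j))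
                     = (\<Sum>i=1..n. r i * a i) / real n" .
  have "(\<Sum>i=1..n. (residual p ip U K h i)\<^sup>2) = (\<Sum>i=1..n. (r i)\<^sup>2 - 2 * (r i * a i) + (a i)\<^sup>2)"
    by (intro sum.cong refl) (simp add: res power2_diff)
  also have "\<dots> = (\<Sum>i=1..n. (r i)\<^sup>2) - 2 * (\<Sum>i=1..n. r i * a i) + (\<Sum>i=1..n. (a i)\<^sup>2)"
    by (simp add: sum.distrib sum_subtractf sum_distrib_left)
  finally have sq: "(\<Sum>i=1..n. (residual p ip U K h i)\<^sup>2)
    = (\<Sum>i=1..n. (r i)\<^sup>2) - 2 * (\<Sum>i=1..n. r i * a i) + (\<Sum>i=1..n. (a i)\<^sup>2)" .
  show ?thesis
    unfolding penalized_objective_def elastic_net_penalty_def sum_subtractf lin sq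
      r_def[symmetric] a_def[symmetric]
    by (simp add: sum.distrib sum_distrib_left add_divide_distrib diff_divide_distrib
        right_diff_distrib distrib_left sum_divide_distrib)
qed

lemma objective_expansion_single_block:
  assumes f: "\<And>j. j \<in> {1..p} \<Longrightarrow> f j \<in> M j" and j: "j \<in> {1..p}" and u: "u \<in> M j"
  defines "d \<equiv> \<lambda>x. u x - f j x"
  shows "penalized_objective n p ip U K lam1 lam2 (f(j := u))
           - penalized_objective n p ip U K lam1 lam2 f
    = elastic_net_penalty (ip j) lam1 lam2 u - elastic_net_penalty (ip j) lam1 lam2 (f j)
      - ip j (residual_mean n p ip U K f j) d
      + (\<Sum>i=1..n. (ip j d (K i j))\<^sup>2) / (2 * real n)"
proof -
  let ?h = "f(j := u)"
  have h: "?h k \<in> M k" if "k \<in> {1..p}" for k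
    using f[OF that] u by simp
  have collapse: "(\<Sum>k=1..p. if k = j then c else 0) = c" for c :: real
    using j by simp
  have "(\<Sum>k=1..p. elastic_net_penalty (ip k) lam1 lam2 (?h k)
                 - elastic_net_penalty (ip k) lam1 lam2 (f k)
                 - ip k (residual_mean n p ip U K f k) (\<lambda>x. ?h k x - f k x))
      = (\<Sum>k=1..p. if k = j
           then elastic_net_penalty (ip j) lam1 lam2 u - elastic_net_penalty (ip j) lam1 lam2 (f j)
                - ip j (residual_mean n p ip U K f j) d else 0)"
    by (intro sum.cong refl)
      (auto simp: d_def inner_function_space.ip_zero_right[OF space residual_mean_mem])
  moreover have "(\<Sum>k=1..p. ip k (\<lambda>x. ?h k x - f k x) (K i k))
      = (\<Sum>k=1..p. if k = j then ip j d (K i j) else 0)" if "i \<in> {1..n}" for i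
    by (intro sum.cong refl)
      (use that in \<open>auto simp: d_def inner_function_space.ip_zero_left[OF space feature_mem]\<close>)
  ultimately show ?thesis
    using objective_expansion[of f ?h lam1 lam2, OF f h] by (simp only: collapse cong: sum.cong)
qed

text \<open>Stationarity in each block separately suffices for a joint minimum because the penalty is a sum
  over the blocks: the coupling between blocks sits in the quadratic part alone, where it
  contributes a nonnegative remainder.\<close>

lemma minimizer_iff_subgradient:
  assumes lam: "0 \<le> lam1" "0 \<le> lam2" and f: "f \<in> (\<Pi>\<^sub>E j\<in>{1..p}. M j)"
  shows "is_arg_min (penalized_objective n p ip U K lam1 lam2) (\<lambda>g. g \<in> (\<Pi>\<^sub>E j\<in>{1..p}. M j)) f \<longleftrightarrow>
    (\<forall>j\<in>{1..p}. inner_function_space.subgradient (M j) (ip j)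
       (elastic_net_penalty (ip j) lam1 lam2) (f j) (residual_mean n p ip U K f j))"
    (is "?min \<longleftrightarrow> ?sub")
proof
  have fM: "f j \<in> M j" if "j \<in> {1..p}" for j
    using f that by auto
  {
    assume ?min
    show ?sub
    proof
      fix j assume j: "j \<in> {1..p}"
      interpret inner_function_space "S j" "M j" "ip j" by (rule space[OF j])
      let ?\<phi> = "elastic_net_penalty (ip j) lam1 lam2"
      let ?G = "residual_mean n p ip U K f j"
      have "ip j ?G (\<lambda>x. u x - f j x) - (?\<phi> u - ?\<phi> (f j)) \<le> 0" if u: "u \<in> M j" for u
      proof (rule linear_coeff_nonpos)
        fix t :: real assume t: "0 < t" "t \<le> 1"
        define d where "d = (\<lambda>x. u x - f j x)"
        define v where "v = (\<lambda>x. (1 - t) * f j x + t * u x)"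
        have d: "d \<in> M j"
          unfolding d_def by (rule diff_mem[OF u fM[OF j]])
        have v: "v \<in> M j"
          unfolding v_def by (intro lin_comb_mem u fM j)
        have vd: "(\<lambda>x. v x - f j x) = (\<lambda>x. t * d x)"
          by (simp add: v_def d_def algebra_simps)
        have "f(j := v) \<in> (\<Pi>\<^sub>E j\<in>{1..p}. M j)"
          using f j v by (auto simp: PiE_iff extensional_def)
        then have "0 \<le> penalized_objective n p ip U K lam1 lam2 (f(j := v))
                        - penalized_objective n p ip U K lam1 lam2 f"
          using \<open>?min\<close> by (auto simp: is_arg_min_def not_less)
        also have "\<dots> = ?\<phi> v - ?\<phi> (f j) - t * ip j ?G d
                        + (\<Sum>i=1..n. (t * ip j d (K i j))\<^sup>2) / (2 * real n)"
          by (subst objective_expansion_single_block[OF _ j v], erule fM)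
            (simp only: vd ip_scale_right[OF d residual_mean_mem[OF j]]
                ip_scale_left[OF d feature_mem[OF _ j]] cong: sum.cong)
        also have "(\<Sum>i=1..n. (t * ip j d (K i j))\<^sup>2) = t\<^sup>2 * (\<Sum>i=1..n. (ip j d (K i j))\<^sup>2)"
          by (simp add: power_mult_distrib sum_distrib_left)
        also have "?\<phi> v \<le> (1 - t) * ?\<phi> (f j) + t * ?\<phi> u"
          unfolding v_def using t by (intro elastic_net_penalty_convex lam fM j u) auto
        finally show "t * (ip j ?G d - (?\<phi> u - ?\<phi> (f j)))
                      \<le> t\<^sup>2 * ((\<Sum>i=1..n. (ip j d (K i j))\<^sup>2) / (2 * real n))"
          by (simp add: algebra_simps)
      qed
      then show "subgradient ?\<phi> (f j) ?G"
        by (force simp: subgradient_def)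
    qed
  }
  {
    assume ?sub
    have "penalized_objective n p ip U K lam1 lam2 f \<le> penalized_objective n p ip U K lam1 lam2 h"
      if h: "h \<in> (\<Pi>\<^sub>E j\<in>{1..p}. M j)" for h
    proof -
      have hM: "h j \<in> M j" if "j \<in> {1..p}" for j
        using h that by auto
      have nonneg: "0 \<le> elastic_net_penalty (ip j) lam1 lam2 (h j)
                 - elastic_net_penalty (ip j) lam1 lam2 (f j)
                 - ip j (residual_mean n p ip U K f j) (\<lambda>x. h j x - f j x)"
        if j: "j \<in> {1..p}" for j
        using \<open>?sub\<close> j hM[OF j] inner_function_space.subgradient_def[OF space[OF j]] by force
      have "0 \<le> penalized_objective n p ip U K lam1 lam2 h
                 - penalized_objective n p ip U K lam1 lam2 f"
        by (subst objective_expansion, erule fM, erule hM)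
          (intro add_nonneg_nonneg sum_nonneg divide_nonneg_nonneg nonneg; simp)
      then show ?thesis by simp
    qed
    then show ?min
      using f by (auto simp: is_arg_min_def not_less)
  }
qed

end

theorem theorem2:
  fixes \<Omega>Y :: "'y metric" and \<Omega>X :: "nat \<Rightarrow> 'x metric"
    and n p :: nat
    and Y :: "nat \<Rightarrow> 'y" and X :: "nat \<Rightarrow> nat \<Rightarrow> 'x"
    and \<kappa> :: "nat \<Rightarrow> 'x \<Rightarrow> 'x \<Rightarrow> real"
    and M :: "nat \<Rightarrow> ('x \<Rightarrow> real) set"
    and ip :: "nat \<Rightarrow> ('x \<Rightarrow> real) \<Rightarrow> ('x \<Rightarrow> real) \<Rightarrow> real"
    and lam1 lam2 :: real and y y0 :: 'y
    and f :: "nat \<Rightarrow> 'x \<Rightarrow> real"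
  assumes "n \<ge> 1"
    and "\<And>i. i \<in> {1..n} \<Longrightarrow> Y i \<in> mspace \<Omega>Y"
    and "\<And>j. j \<in> {1..p} \<Longrightarrow> separable_space (mtopology_of (\<Omega>X j))"
    and "\<And>i j. \<lbrakk>i \<in> {1..n}; j \<in> {1..p}\<rbrakk> \<Longrightarrow> X i j \<in> mspace (\<Omega>X j)"
    and "\<And>j. j \<in> {1..p} \<Longrightarrow> pos_def_kernel (mspace (\<Omega>X j)) (\<kappa> j)"
    and "\<And>j. j \<in> {1..p} \<Longrightarrow> rkhs (mspace (\<Omega>X j)) (\<kappa> j) (M j) (ip j)"
    and "lam1 > 0" and "lam2 > 0"
    and "y \<in> mspace \<Omega>Y" and "y0 \<in> mspace \<Omega>Y"
    and "f \<in> (\<Pi>\<^sub>E j\<in>{1..p}. M j)"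
  shows "let U = (\<lambda>i. (mdist \<Omega>Y (Y i) y)\<^sup>2 - (mdist \<Omega>Y (Y i) y0)\<^sup>2);
             K = (\<lambda>i j. kernel_section (mspace (\<Omega>X j)) (\<kappa> j) (X i j))
         in is_arg_min (penalized_objective n p ip U K lam1 lam2) (\<lambda>g. g \<in> (\<Pi>\<^sub>E j\<in>{1..p}. M j)) f \<longleftrightarrow>
            (\<forall>j\<in>{1..p}.
               (ip_norm (ip j) (f j) > 0 \<longrightarrow>
                  (\<lambda>t. residual_mean n p ip U K f j t - lam2 * f j t)
                    = (\<lambda>t. lam1 * (f j t / ip_norm (ip j) (f j)))) \<and>
               (ip_norm (ip j) (f j) = 0 \<longrightarrow>
                  ip_norm (ip j) (residual_mean n p ip U K f j) \<le> lam1))"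
proof -
  define U where "U = (\<lambda>i. (mdist \<Omega>Y (Y i) y)\<^sup>2 - (mdist \<Omega>Y (Y i) y0)\<^sup>2)"
  define K where "K = (\<lambda>i j. kernel_section (mspace (\<Omega>X j)) (\<kappa> j) (X i j))"
  interpret additive_model n p "\<lambda>j. mspace (\<Omega>X j)" M ip U K
  proof (rule additive_model.intro)
    show "inner_function_space (mspace (\<Omega>X j)) (M j) (ip j)" if "j \<in> {1..p}" for j
      using rkhs.axioms(1)[OF assms(6)[OF that]] .
    show "K i j \<in> M j" if "i \<in> {1..n}" "j \<in> {1..p}" for i j
      unfolding K_def using assms(4,6) that by (blast intro: rkhs.section_mem)
  qed
  have "inner_function_space.subgradient (M j) (ip j) (elastic_net_penalty (ip j) lam1 lam2)
          (f j) (residual_mean n p ip U K f j) \<longleftrightarrow>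
        (ip_norm (ip j) (f j) > 0 \<longrightarrow>
           (\<lambda>t. residual_mean n p ip U K f j t - lam2 * f j t)
             = (\<lambda>t. lam1 * (f j t / ip_norm (ip j) (f j)))) \<and>
        (ip_norm (ip j) (f j) = 0 \<longrightarrow> ip_norm (ip j) (residual_mean n p ip U K f j) \<le> lam1)"
    if j: "j \<in> {1..p}" for j
  proof -
    interpret inner_function_space "mspace (\<Omega>X j)" "M j" "ip j" by (rule space[OF j])
    have fj: "f j \<in> M j" using assms(11) j by auto
    note G = residual_mean_mem[OF j, of f]
    show ?thesis
    proof (cases "ip_norm (ip j) (f j) = 0")
      case True
      then show ?thesis
        using subgradient_elastic_net_at_zero[OF _ _ G, of lam1 lam2] ip_norm_eq_zero[OF fj] assms
        by simp
    next
      case False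
      then have "ip_norm (ip j) (f j) > 0"
        using ip_norm_nonneg[OF fj] by simp
      then show ?thesis
        using subgradient_elastic_net_at_nonzero[OF _ _ fj G, of lam1 lam2] assms by simp
    qed
  qed
  then show ?thesis
    unfolding Let_def U_def[symmetric] K_def[symmetric]
    using minimizer_iff_subgradient[of lam1 lam2 f] assms by simp
qed

end
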